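(* Let $\lambda>0$, $n\in\mathbb N_0$, $k\in\mathbb N$ and $\nu\in\mathbb R$ with $k-\nu\le0$. Then for $x>0$, $${}_{-\infty}D_x^{k,\lambda}\big\{\mathcal L_n^{(-\nu,\lambda)}(x)\big\}=\frac{\Gamma(n+\nu+1)}{\Gamma(n+\nu-k+1)}\,\mathcal L_n^{(k-\nu,\lambda)}(x),$$ $${}_xD_\infty^{k,\lambda}\big\{\mathcal L_n^{(-\nu,\lambda)}(x)\big\}=(-1)^k\frac{\Gamma(n+k+1)}{\Gamma(n+1)}\,\mathcal L_{n+k}^{(k-\nu,\lambda)}(x).$$
   Context: $\mathbb N=\{1,2,\dots\}$, $\mathbb N_0=\mathbb N\cup\{0\}$. For $\alpha>-1$, $L_n^{(\alpha)}$ is the Laguerre polynomial $L_n^{(\alpha)}(x)=\frac{(\alpha+1)_n}{n!}\,{}_1F_1(-n;\alpha+1;x)$. The generalized Laguerre functions are, for $\alpha\in\mathbb R$, $\lambda>0$, $x>0$, $n\in\mathbb N_0$, $$\mathcal L_n^{(\alpha,\lambda)}(x)=\begin{cases}x^{-\alpha}e^{-\lambda x}L_n^{(-\alpha)}(2\lambda x),&\alpha<0,\\ e^{-\lambda x}L_n^{(\alpha)}(2\lambda x),&\alpha\ge0.\end{cases}$$ The tempered derivatives of integer order $k$ are the local operators $${}_{-\infty}D_x^{k,\lambda}u=e^{-\lambda x}\frac{d^k}{dx^k}\{e^{\lambda x}u\},\qquad {}_xD_\infty^{k,\lambda}u=(-1)^k e^{\lambda x}\frac{d^k}{dx^k}\{e^{-\lambda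 x}u\}.$$ *)

theory Defs
  imports "HOL-Analysis.Analysis"
begin

definition hyp_1F1 :: "real \<Rightarrow> real \<Rightarrow> real \<Rightarrow> real" where
  "hyp_1F1 a b x = eval_fps (fps_hypergeo [a] [b] 1) x"

text \<open>Only meaningful for \<open>\<alpha> > -1\<close>, where no denominator \<open>pochhammer (\<alpha> + 1) j\<close> vanishes.\<close>

definition laguerre :: "nat \<Rightarrow> real \<Rightarrow> real \<Rightarrow> real" where
  "laguerre n \<alpha> x = pochhammer (\<alpha> + 1) n / fact n * hyp_1F1 (- real n) (\<alpha> + 1) x"

text \<open>Only the values at \<open>x > 0\<close> matter. The second parameter \<open>r\<close> is the rate, usually
  written lambda.\<close>

definition laguerre_fun :: "nat \<Rightarrow> real \<Rightarrow> real \<Rightarrow> real \<Rightarrow> real" where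
  "laguerre_fun n \<alpha> r x =
     (if \<alpha> < 0 then x powr (- \<alpha>) * exp (- r * x) * laguerre n (- \<alpha>) (2 * r * x)
      else exp (- r * x) * laguerre n \<alpha> (2 * r * x))"

definition tempered_deriv_left :: "nat \<Rightarrow> real \<Rightarrow> (real \<Rightarrow> real) \<Rightarrow> real \<Rightarrow> real" where
  "tempered_deriv_left k r u x = exp (- r * x) * (deriv ^^ k) (\<lambda>y. exp (r * y) * u y) x"

definition tempered_deriv_right :: "nat \<Rightarrow> real \<Rightarrow> (real \<Rightarrow> real) \<Rightarrow> real \<Rightarrow> real" where
  "tempered_deriv_right k r u x =
     (-1) ^ k * exp (r * x) * (deriv ^^ k) (\<lambda>y. exp (- r * y) * u y) x"

text \<open>The constant \<open>deriv\<close> is total, so an equation between derivatives does not assert that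
  they exist; existence on the half-line of the derivatives up to order \<open>k\<close> is this predicate.\<close>

definition times_differentiable_pos :: "nat \<Rightarrow> (real \<Rightarrow> real) \<Rightarrow> bool" where
  "times_differentiable_pos k f \<longleftrightarrow> (\<forall>j<k. (deriv ^^ j) f differentiable_on {0<..})"

end

theory Submission
  imports Defs
begin

text \<open>
  Write \<open>L n a t\<close> for the Laguerre polynomial of degree \<open>n\<close> and parameter \<open>a\<close>, and let
  \<open>c = 2 * r\<close>. For \<open>x > 0\<close> the exponential of the left operator cancels the weight
  \<open>exp (- r * x)\<close> and that of the right operator squares it, so the functions to be
  differentiated are \<open>x powr \<nu> * L n \<nu> (c * x)\<close> and
  \<open>exp (- c * x) * x powr \<nu> * L n \<nu> (c * x)\<close>. For \<open>a > 0\<close> a single derivative stays, up to a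
  constant factor, in the same family:

    \<open>(x powr a * L n a (c * x))' = (n + a) * x powr (a - 1) * L n (a - 1) (c * x)\<close>,

    \<open>(exp (- c * x) * x powr a * L n a (c * x))' =
      (n + 1) * exp (- c * x) * x powr (a - 1) * L (n + 1) (a - 1) (c * x)\<close>.

  The first rule (\<open>powr_laguerre_has_derivative\<close>) is a termwise computation on the finite
  hypergeometric sum; the second (\<open>powr_exp_laguerre_has_derivative\<close>) follows from the first by
  the product rule and the contiguous relation
  \<open>(n + a) * L n (a - 1) t - t * L n a t = (n + 1) * L (n + 1) (a - 1) t\<close>
  (\<open>laguerre_contiguous\<close>). Applied \<open>k\<close> times, the rules lower the parameter from \<open>\<nu>\<close> to
  \<open>\<nu> - k\<close>. The hypothesis \<open>k \<le> \<nu>\<close> keeps the parameter positive before every step, and the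
  factors collected on the way telescope to the two Gamma quotients.
\<close>

section \<open>Coefficients and the contiguous relation\<close>

definition laguerre_coeff :: "nat \<Rightarrow> real \<Rightarrow> nat \<Rightarrow> real" where
  "laguerre_coeff n a j = pochhammer (a + 1) n / fact n *
     (pochhammer (- real n) j / (pochhammer (a + 1) j * fact j))"

text \<open>The bound \<open>N\<close> may exceed the degree, because \<open>pochhammer (- n) j\<close> vanishes for \<open>j > n\<close>.
  This lets Laguerre polynomials of different degrees be compared over a common index range.\<close>

lemma laguerre_eq_sum:
  assumes "n \<le> N"
  shows "laguerre n a x = (\<Sum>j\<le>N. laguerre_coeff n a j * x ^ j)"
proof -
  have "hyp_1F1 (- real n) (a + 1) x =
      (\<Sum>j. pochhammer (- real n) j / (pochhammer (a + 1) j * fact j) * x ^ j)"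
    by (simp add: hyp_1F1_def eval_fps_def)
  also have "\<dots> = (\<Sum>j\<le>N. pochhammer (- real n) j / (pochhammer (a + 1) j * fact j) * x ^ j)"
    using assms by (intro suminf_finite) (auto simp: pochhammer_of_nat_eq_0_iff)
  finally show ?thesis
    by (simp add: laguerre_def laguerre_coeff_def sum_distrib_left mult.assoc)
qed

text \<open>Both sides reduce to the same product, because
  \<open>a * pochhammer (a + 1) m = pochhammer a m * (a + m)\<close>: for \<open>m = j\<close> it converts the
  denominator, for \<open>m = n\<close> the prefactor.\<close>

lemma laguerre_coeff_lower:
  assumes "a > 0"
  shows "(a + real j) * laguerre_coeff n a j = (real n + a) * laguerre_coeff n (a - 1) j"
proof -
  have shift: "a * pochhammer (a + 1) m = pochhammer a m * (a + real m)" for m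
    using pochhammer_rec[of a m] pochhammer_Suc[of a m] by simp
  have pos: "pochhammer a j > 0"
    using assms by (rule pochhammer_pos)
  define s where "s = a + real j"
  have s: "s > 0" using assms by (simp add: s_def)
  have P: "pochhammer (a + 1) j = pochhammer a j * s / a"
    and Q: "pochhammer (a + 1) n = pochhammer a n * (real n + a) / a"
    using shift[of j] shift[of n] assms by (simp_all add: field_simps s_def)
  show ?thesis
    using assms pos s unfolding laguerre_coeff_def P Q s_def[symmetric] by simp
qed

lemma laguerre_coeff_contiguous_0:
  "(real n + a) * laguerre_coeff n (a - 1) 0 = (real n + 1) * laguerre_coeff (Suc n) (a - 1) 0"
proof -
  have "(real n + 1) * (z / fact (Suc n)) = z / fact n" for z :: real
    by (simp add: divide_simps)
  from this[of "pochhammer a n * (a + real n)"] show ?thesis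
    by (simp add: laguerre_coeff_def pochhammer_Suc mult.commute add.commute del: fact_Suc)
qed

text \<open>All three terms are multiples of one constant \<open>K\<close>, with factors \<open>j - n\<close>, \<open>j + 1\<close> and
  \<open>- (n + 1)\<close>; the relation is then \<open>(j - n) - (j + 1) = - (n + 1)\<close>.\<close>

lemma laguerre_coeff_contiguous_Suc:
  assumes "a > 0"
  shows "(real n + a) * laguerre_coeff n (a - 1) (Suc j) - laguerre_coeff n a j =
    (real n + 1) * laguerre_coeff (Suc n) (a - 1) (Suc j)"
proof -
  define P where "P = pochhammer (a + 1) j"
  define B where "B = pochhammer (- real n) j"
  define A where "A = pochhammer a n"
  have P: "P > 0" unfolding P_def using assms by (simp add: pochhammer_pos)
  have 1: "pochhammer a (Suc j) = a * P"
    by (simp add: P_def pochhammer_rec)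
  have 2: "pochhammer (- real n) (Suc j) = B * (real j - real n)"
    by (simp add: B_def pochhammer_Suc)
  have 3: "pochhammer (- real (Suc n)) (Suc j) = - (real n + 1) * B"
    by (simp add: B_def pochhammer_rec)
  have 4: "pochhammer a (Suc n) = A * (a + real n)"
    by (simp add: A_def pochhammer_Suc)
  have 5: "pochhammer (a + 1) n = A * (a + real n) / a"
    using pochhammer_rec[of a n] 4 assms by (simp add: field_simps)
  have 6: "laguerre_coeff n (a - 1) (Suc j) =
      A / fact n * (B * (real j - real n) / (a * P * fact (Suc j)))"
    unfolding laguerre_coeff_def using 1 2 by (simp add: A_def)
  have 7: "laguerre_coeff n a j =
      A * (a + real n) / a / fact n * (B / (P * fact j))"
    unfolding laguerre_coeff_def 5 by (simp add: P_def B_def)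
  have 8: "laguerre_coeff (Suc n) (a - 1) (Suc j) =
      A * (a + real n) / fact (Suc n) * (- (real n + 1) * B / (a * P * fact (Suc j)))"
    unfolding laguerre_coeff_def 3 using 1 4 by simp
  define K where "K = A * (a + real n) * B / (fact n * a * P * fact (Suc j))"
  have "(real n + a) * laguerre_coeff n (a - 1) (Suc j) = K * (real j - real n)"
    unfolding 6 K_def by (simp add: field_simps)
  moreover have "laguerre_coeff n a j = K * (real j + 1)"
    unfolding 7 K_def using P assms by (simp add: divide_simps)
  moreover have "(real n + 1) * laguerre_coeff (Suc n) (a - 1) (Suc j) = K * - (real n + 1)"
    unfolding 8 K_def using P assms by (simp add: divide_simps)
  ultimately show ?thesis by (simp add: algebra_simps)
qed

text \<open>Comparing coefficients of \<open>t ^ j\<close>: the factor \<open>t\<close> shifts the index of \<open>laguerre_coeff n a\<close>,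
  so the constant term has to be treated separately.\<close>

lemma laguerre_contiguous:
  assumes "a > 0"
  shows "(real n + a) * laguerre n (a - 1) t - t * laguerre n a t =
    (real n + 1) * laguerre (Suc n) (a - 1) t"
proof -
  have "(real n + a) * laguerre n (a - 1) t - t * laguerre n a t =
      (\<Sum>j\<le>Suc n. (real n + a) * laguerre_coeff n (a - 1) j * t ^ j)
        - (\<Sum>j\<le>n. laguerre_coeff n a j * t ^ Suc j)"
    by (simp only: laguerre_eq_sum[of n "Suc n" "a - 1", OF le_SucI[OF order.refl]]
        laguerre_eq_sum[of n n a, OF order.refl])
      (simp add: sum_distrib_left algebra_simps)
  also have "\<dots> = (real n + a) * laguerre_coeff n (a - 1) 0 +
      (\<Sum>j\<le>n. ((real n + a) * laguerre_coeff n (a - 1) (Suc j) - laguerre_coeff n a j) * t ^ Suc j)"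
    by (subst sum.atMost_Suc_shift) (simp add: sum_subtractf left_diff_distrib)
  also have "\<dots> = (real n + 1) * laguerre_coeff (Suc n) (a - 1) 0 +
      (\<Sum>j\<le>n. (real n + 1) * laguerre_coeff (Suc n) (a - 1) (Suc j) * t ^ Suc j)"
    by (simp only: laguerre_coeff_contiguous_0 laguerre_coeff_contiguous_Suc[OF assms])
  also have "\<dots> = (\<Sum>j\<le>Suc n. (real n + 1) * laguerre_coeff (Suc n) (a - 1) j * t ^ j)"
    by (simp only: sum.atMost_Suc_shift power_0 mult_1_right)
  also have "\<dots> = (real n + 1) * laguerre (Suc n) (a - 1) t"
    by (simp only: laguerre_eq_sum[of "Suc n" "Suc n", OF order.refl] sum_distrib_left mult.assoc)
  finally show ?thesis .
qed

section \<open>Differentiation rules that lower the parameter\<close>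

text \<open>Differentiating \<open>x powr a * (c * x) ^ j\<close> yields the factor \<open>a + j\<close>, which is exactly what turns the
  \<open>j\<close>-th coefficient for parameter \<open>a\<close> into the one for parameter \<open>a - 1\<close>.\<close>

lemma powr_laguerre_has_derivative:
  assumes "a > 0" "x > 0"
  shows "((\<lambda>y. y powr a * laguerre n a (c * y)) has_real_derivative
    (real n + a) * (x powr (a - 1) * laguerre n (a - 1) (c * x))) (at x)"
proof -
  have monomial: "((\<lambda>y. y powr a * (c * y) ^ j) has_real_derivative
      (a + real j) * (x powr (a - 1) * (c * x) ^ j)) (at x)" for j
  proof -
    have powr: "x powr a = x * x powr (a - 1)"
      using assms(2) by (simp add: powr_mult_base)
    have "((\<lambda>y. y powr a * (c * y) ^ j) has_real_derivative
        a * x powr (a - 1) * (c * x) ^ j + real j * (c * x) ^ (j - 1) * c * x powr a) (at x)"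
      using assms(2) by (auto intro!: derivative_eq_intros)
    also have "a * x powr (a - 1) * (c * x) ^ j + real j * (c * x) ^ (j - 1) * c * x powr a =
        (a + real j) * (x powr (a - 1) * (c * x) ^ j)"
      unfolding powr by (cases j) (simp_all add: algebra_simps)
    finally show ?thesis .
  qed
  have "((\<lambda>y. \<Sum>j\<le>n. laguerre_coeff n a j * (y powr a * (c * y) ^ j)) has_real_derivative
      (\<Sum>j\<le>n. laguerre_coeff n a j * ((a + real j) * (x powr (a - 1) * (c * x) ^ j)))) (at x)"
    by (intro DERIV_sum DERIV_cmult monomial)
  moreover have "(\<lambda>y. y powr a * laguerre n a (c * y)) =
      (\<lambda>y. \<Sum>j\<le>n. laguerre_coeff n a j * (y powr a * (c * y) ^ j))"
    by (simp add: laguerre_eq_sum[of n n] sum_distrib_left mult.left_commute)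
  moreover have "(\<Sum>j\<le>n. laguerre_coeff n a j * ((a + real j) * (x powr (a - 1) * (c * x) ^ j))) =
      (real n + a) * (x powr (a - 1) * laguerre n (a - 1) (c * x))"
  proof -
    have "laguerre_coeff n a j * ((a + real j) * (x powr (a - 1) * (c * x) ^ j)) =
        (real n + a) * (x powr (a - 1) * (laguerre_coeff n (a - 1) j * (c * x) ^ j))" for j
      using laguerre_coeff_lower[OF assms(1), of j n]
      by (metis (no_types) mult.assoc mult.commute mult.left_commute)
    then show ?thesis
      by (simp only: laguerre_eq_sum[of n n, OF order.refl] sum_distrib_left)
  qed
  ultimately show ?thesis by simp
qed

text \<open>The product rule contributes \<open>- c\<close> times the function itself. As
  \<open>x powr a = x * x powr (a - 1)\<close>, the two terms share the factor \<open>x powr (a - 1)\<close> and combine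
  by \<open>laguerre_contiguous\<close> at \<open>t = c * x\<close>.\<close>

lemma powr_exp_laguerre_has_derivative:
  assumes "a > 0" "x > 0"
  shows "((\<lambda>y. exp (- c * y) * (y powr a * laguerre n a (c * y))) has_real_derivative
    (real n + 1) * (exp (- c * x) * (x powr (a - 1) * laguerre (Suc n) (a - 1) (c * x)))) (at x)"
proof -
  have powr: "x powr a = x * x powr (a - 1)"
    using assms(2) by (simp add: powr_mult_base)
  have "((\<lambda>y. exp (- c * y)) has_real_derivative exp (- c * x) * - c) (at x)"
    by (auto intro!: derivative_eq_intros)
  from DERIV_mult[OF this powr_laguerre_has_derivative[OF assms, of n c]]
  have "((\<lambda>y. exp (- c * y) * (y powr a * laguerre n a (c * y))) has_real_derivative
      exp (- c * x) * x powr (a - 1) *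
        ((real n + a) * laguerre n (a - 1) (c * x) - (c * x) * laguerre n a (c * x))) (at x)"
    unfolding powr by (simp add: algebra_simps)
  then show ?thesis
    unfolding laguerre_contiguous[OF assms(1)] by (simp add: mult_ac)
qed

section \<open>Iterated derivatives on the half-line\<close>

text \<open>The functions \<open>F j\<close> agree with the iterated derivatives only on the half-line, so
  differentiability has to be transferred on an open set at each step.\<close>

lemma iterated_deriv_pos:
  fixes f :: "real \<Rightarrow> real"
  assumes start: "\<And>x. x > 0 \<Longrightarrow> f x = F 0 x"
    and step: "\<And>j x. j < k \<Longrightarrow> x > 0 \<Longrightarrow> (F j has_real_derivative F (Suc j) x) (at x)"
  shows "times_differentiable_pos k f" and "x > 0 \<Longrightarrow> (deriv ^^ k) f x = F k x"
proof -
  have transfer: "((deriv ^^ j) f has_real_derivative F (Suc j) x) (at x)"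
    if "j < k" "x > 0" and eq: "\<And>y. y > 0 \<Longrightarrow> (deriv ^^ j) f y = F j y" for j x
    by (rule has_field_derivative_transform_within_open[OF step[OF that(1,2)], of "{0<..}"])
      (use that in auto)
  have eq: "(deriv ^^ j) f x = F j x" if "j \<le> k" "x > 0" for j x
    using that
  proof (induction j arbitrary: x)
    case 0
    then show ?case by (simp add: start)
  next
    case (Suc j)
    then show ?case
      using transfer[of j x] by (simp add: DERIV_imp_deriv)
  qed
  show "x > 0 \<Longrightarrow> (deriv ^^ k) f x = F k x"
    by (simp add: eq)
  have "(deriv ^^ j) f differentiable (at x within {0<..})" if "j < k" "x > 0" for j x
    using transfer[OF that] eq that
    by (meson differentiable_at_withinI less_imp_le real_differentiable_def)
  then show "times_differentiable_pos k f"
    by (simp add: times_differentiable_pos_def differentiable_on_def)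
qed

text \<open>The factor of step \<open>j\<close> is \<open>z = n + \<nu> - j\<close>, and \<open>Gamma (z + 1) = z * Gamma z\<close> absorbs it
  into the denominator of the Gamma quotient.\<close>

lemma iterated_deriv_powr_laguerre:
  fixes f :: "real \<Rightarrow> real"
  assumes "real k \<le> \<nu>" and f: "\<And>x. x > 0 \<Longrightarrow> f x = x powr \<nu> * laguerre n \<nu> (c * x)"
  shows "times_differentiable_pos k f"
    and "x > 0 \<Longrightarrow> (deriv ^^ k) f x = Gamma (real n + \<nu> + 1) / Gamma (real n + \<nu> - real k + 1) *
      (x powr (\<nu> - real k) * laguerre n (\<nu> - real k) (c * x))"
proof -
  define F where "F = (\<lambda>j x. Gamma (real n + \<nu> + 1) / Gamma (real n + \<nu> - real j + 1) *
    (x powr (\<nu> - real j) * laguerre n (\<nu> - real j) (c * x)))"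
  have "Gamma (real n + \<nu> + 1) > 0"
    using assms(1) by (intro Gamma_real_pos) linarith
  then have start: "f x = F 0 x" if "x > 0" for x
    using that by (simp add: F_def f)
  have step: "(F j has_real_derivative F (Suc j) x) (at x)" if "j < k" "x > 0" for j x
  proof -
    define z where "z = real n + \<nu> - real j"
    have a: "\<nu> - real j > 0" using that assms(1) by linarith
    then have "z > 0" by (simp add: z_def)
    then have "Gamma (z + 1) = z * Gamma z" "Gamma z > 0"
      by (auto intro!: Gamma_plus1 Gamma_real_pos dest: nonpos_Ints_nonpos)
    then have tele: "Gamma (real n + \<nu> + 1) / Gamma (z + 1) * z = Gamma (real n + \<nu> + 1) / Gamma z"
      using \<open>z > 0\<close> by simp
    have z': "real n + (\<nu> - real j) = z" "real n + \<nu> - real (Suc j) + 1 = z"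
      "\<nu> - real (Suc j) = \<nu> - real j - 1"
      by (simp_all add: z_def)
    show ?thesis
      using DERIV_cmult[OF powr_laguerre_has_derivative[OF a that(2), of n c],
          of "Gamma (real n + \<nu> + 1) / Gamma (z + 1)"]
      unfolding F_def z' z_def[symmetric] by (simp only: tele mult.assoc[symmetric])
  qed
  note iter = iterated_deriv_pos[of f F k, OF start step]
  show "times_differentiable_pos k f" by (rule iter(1))
  show "x > 0 \<Longrightarrow> (deriv ^^ k) f x = Gamma (real n + \<nu> + 1) / Gamma (real n + \<nu> - real k + 1) *
      (x powr (\<nu> - real k) * laguerre n (\<nu> - real k) (c * x))"
    using iter(2) by (simp add: F_def)
qed

text \<open>Each step raises the degree, so the factor of step \<open>j\<close> is \<open>n + j + 1\<close>; here the
  numerator of the Gamma quotient absorbs it.\<close>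

lemma iterated_deriv_powr_exp_laguerre:
  fixes f :: "real \<Rightarrow> real"
  assumes "real k \<le> \<nu>"
    and f: "\<And>x. x > 0 \<Longrightarrow> f x = exp (- c * x) * (x powr \<nu> * laguerre n \<nu> (c * x))"
  shows "times_differentiable_pos k f"
    and "x > 0 \<Longrightarrow> (deriv ^^ k) f x = Gamma (real n + real k + 1) / Gamma (real n + 1) *
      (exp (- c * x) * (x powr (\<nu> - real k) * laguerre (n + k) (\<nu> - real k) (c * x)))"
proof -
  define F where "F = (\<lambda>j x. Gamma (real n + real j + 1) / Gamma (real n + 1) *
    (exp (- c * x) * (x powr (\<nu> - real j) * laguerre (n + j) (\<nu> - real j) (c * x))))"
  have "Gamma (real n + 1) \<noteq> 0"
    by (rule less_imp_neq[OF Gamma_real_pos, symmetric]) linarith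
  then have start: "f x = F 0 x" if "x > 0" for x
    using that by (simp add: F_def f)
  have step: "(F j has_real_derivative F (Suc j) x) (at x)" if "j < k" "x > 0" for j x
  proof -
    define z where "z = real n + real j + 1"
    have a: "\<nu> - real j > 0" using that assms(1) by linarith
    have "z > 0" by (simp add: z_def)
    then have "Gamma (z + 1) = z * Gamma z"
      by (auto intro!: Gamma_plus1 dest: nonpos_Ints_nonpos)
    then have tele: "Gamma z / Gamma (real n + 1) * z = Gamma (z + 1) / Gamma (real n + 1)"
      by simp
    have z': "real (n + j) + 1 = z" "real n + real (Suc j) + 1 = z + 1"
      "\<nu> - real (Suc j) = \<nu> - real j - 1" "n + Suc j = Suc (n + j)"
      by (simp_all add: z_def)
    show ?thesis
      using DERIV_cmult[OF powr_exp_laguerre_has_derivative[OF a that(2), of c "n + j"],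
          of "Gamma z / Gamma (real n + 1)"]
      unfolding F_def z' z_def[symmetric] by (simp only: tele mult.assoc[symmetric])
  qed
  note iter = iterated_deriv_pos[of f F k, OF start step]
  show "times_differentiable_pos k f" by (rule iter(1))
  show "x > 0 \<Longrightarrow> (deriv ^^ k) f x = Gamma (real n + real k + 1) / Gamma (real n + 1) *
      (exp (- c * x) * (x powr (\<nu> - real k) * laguerre (n + k) (\<nu> - real k) (c * x)))"
    using iter(2) by (simp add: F_def)
qed

section \<open>Tempered derivatives of generalized Laguerre functions\<close>

text \<open>Both branches of the definition of \<open>laguerre_fun\<close> agree at parameter \<open>0\<close>, since
  \<open>x powr 0 = 1\<close> for \<open>x > 0\<close>; this covers the endpoint \<open>\<nu> = k\<close>.\<close>

lemma laguerre_fun_uminus: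
  assumes "a \<ge> 0" "x > 0"
  shows "laguerre_fun n (- a) r x = exp (- r * x) * (x powr a * laguerre n a (2 * r * x))"
  using assms by (cases "a = 0") (simp_all add: laguerre_fun_def)

theorem theorem1:
  fixes r \<nu> :: real and n k :: nat
  assumes "r > 0" and "k \<ge> 1" and "real k - \<nu> \<le> 0"
  shows "times_differentiable_pos k (\<lambda>y. exp (r * y) * laguerre_fun n (- \<nu>) r y) \<and>
         times_differentiable_pos k (\<lambda>y. exp (- r * y) * laguerre_fun n (- \<nu>) r y) \<and>
         (\<forall>x>0.
           tempered_deriv_left k r (laguerre_fun n (- \<nu>) r) x =
             Gamma (real n + \<nu> + 1) / Gamma (real n + \<nu> - real k + 1) *
             laguerre_fun n (real k - \<nu>) r x \<and>
           tempered_deriv_right k r (laguerre_fun n (- \<nu>) r) x =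
             (-1) ^ k * (Gamma (real n + real k + 1) / Gamma (real n + 1)) *
             laguerre_fun (n + k) (real k - \<nu>) r x)"
proof -
  let ?L = "\<lambda>y. exp (r * y) * laguerre_fun n (- \<nu>) r y"
  let ?R = "\<lambda>y. exp (- r * y) * laguerre_fun n (- \<nu>) r y"
  have \<nu>: "real k \<le> \<nu>" "\<nu> \<ge> 0" using assms by linarith+
  have cancel: "exp (r * y) * exp (- r * y) = 1" for y
    by (simp add: exp_minus)
  have double: "exp (- r * y) * exp (- r * y) = exp (- (2 * r) * y)" for y
    by (simp flip: exp_add)
  have L: "?L y = y powr \<nu> * laguerre n \<nu> (2 * r * y)" if "y > 0" for y
    by (simp only: laguerre_fun_uminus[OF \<nu>(2) that] mult.assoc[symmetric] cancel mult_1_left)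
  have R: "?R y = exp (- (2 * r) * y) * (y powr \<nu> * laguerre n \<nu> (2 * r * y))" if "y > 0" for y
    by (simp only: laguerre_fun_uminus[OF \<nu>(2) that] mult.assoc[symmetric] double)
  have left: "(deriv ^^ k) ?L x = Gamma (real n + \<nu> + 1) / Gamma (real n + \<nu> - real k + 1) *
      (x powr (\<nu> - real k) * laguerre n (\<nu> - real k) (2 * r * x))" if "x > 0" for x
    by (rule iterated_deriv_powr_laguerre(2)[OF \<nu>(1) L that])
  have right: "(deriv ^^ k) ?R x = Gamma (real n + real k + 1) / Gamma (real n + 1) *
      (exp (- (2 * r) * x) * (x powr (\<nu> - real k) * laguerre (n + k) (\<nu> - real k) (2 * r * x)))"
    if "x > 0" for x
    by (rule iterated_deriv_powr_exp_laguerre(2)[OF \<nu>(1) R that])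
  have target: "laguerre_fun m (real k - \<nu>) r x =
      exp (- r * x) * (x powr (\<nu> - real k) * laguerre m (\<nu> - real k) (2 * r * x))"
    if "x > 0" for m x
    using laguerre_fun_uminus[of "\<nu> - real k" x m r] \<nu>(1) that by simp
  have "tempered_deriv_left k r (laguerre_fun n (- \<nu>) r) x =
      Gamma (real n + \<nu> + 1) / Gamma (real n + \<nu> - real k + 1) *
      laguerre_fun n (real k - \<nu>) r x" if "x > 0" for x
    unfolding tempered_deriv_left_def left[OF that] target[OF that]
    by (rule mult.left_commute)
  moreover have "tempered_deriv_right k r (laguerre_fun n (- \<nu>) r) x =
      (-1) ^ k * (Gamma (real n + real k + 1) / Gamma (real n + 1)) *
      laguerre_fun (n + k) (real k - \<nu>) r x" if "x > 0" for x
  proof -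
    have weight: "exp (- r * x) = exp (r * x) * exp (- (2 * r) * x)"
      by (simp flip: exp_add)
    show ?thesis
      unfolding tempered_deriv_right_def right[OF that] target[OF that] weight
      by (simp only: mult_ac)
  qed
  moreover have "times_differentiable_pos k ?L"
    by (rule iterated_deriv_powr_laguerre(1)[OF \<nu>(1) L])
  moreover have "times_differentiable_pos k ?R"
    by (rule iterated_deriv_powr_exp_laguerre(1)[OF \<nu>(1) R])
  ultimately show ?thesis
    by blast
qed

end
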